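(* Let $n$ be a positive integer. (i) The number of partitions of $n$ into distinct parts with odd rank is odd if and only if $n=\frac{k(3k-(-1)^k)}{2}$ for some positive integer $k$. (ii) The number of partitions of $n$ into distinct parts with even rank is odd if and only if $n=\frac{k(3k+(-1)^k)}{2}$ for some positive integer $k$.
   Context: The rank of a partition $\lambda$ is $\lambda_1-\ell(\lambda)$, its largest part minus its number of parts. *)

theory Defs
  imports Complex_Main "HOL-Library.Multiset"
begin

definition partitions :: "nat \<Rightarrow> nat multiset set" where
  "partitions n = {p. 0 \<notin># p \<and> sum_mset p = n}"

definition distinct_parts :: "nat multiset \<Rightarrow> bool" where
  "distinct_parts p \<longleftrightarrow> (\<forall>x. count p x \<le> 1)"

text \<open>The rank is integer-valued, as it may be negative. It is only meaningful for nonempty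
  partitions, i.e. for partitions of a positive integer.\<close>
definition partition_rank :: "nat multiset \<Rightarrow> int" where
  "partition_rank p = int (Max (set_mset p)) - int (size p)"

text \<open>Finiteness ensures that \<^const>\<open>card\<close> really counts partitions.\<close>
lemma size_le_sum_mset: "0 \<notin># p \<Longrightarrow> size p \<le> sum_mset p" for p :: "nat multiset"
  by (induction p) auto

lemma finite_partitions: "finite (partitions n)"
proof -
  have "partitions n \<subseteq> mset ` {xs. set xs \<subseteq> {..n} \<and> length xs \<le> n}"
  proof
    fix p assume p: "p \<in> partitions n"
    obtain xs where xs: "mset xs = p" using ex_mset by blast
    have "length xs \<le> n"
      using p size_le_sum_mset[of p] xs by (auto simp: partitions_def)
    moreover have "x \<le> n" if "x \<in> set xs" for x
      using p xs member_le_sum_list[of x xs] that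
      by (auto simp: partitions_def sum_mset_sum_list)
    ultimately show "p \<in> mset ` {xs. set xs \<subseteq> {..n} \<and> length xs \<le> n}"
      using xs by auto
  qed
  then show ?thesis
    using finite_lists_length_le[of "{..n}" n] by (auto intro: finite_subset)
qed

end

theory Submission
  imports Defs
begin

text \<open>Franklin's involution either moves the smallest part onto the top diagonal of the Ferrers
  diagram or conversely. It changes the largest part and the number of parts by one in opposite
  directions, so it preserves the parity of the rank. Its fixed points are the partitions with
  parts \<open>k, \<dots>, 2k - 1\<close> or \<open>k + 1, \<dots>, 2k\<close>, which have size \<open>k(3k \<mp> 1)/2\<close> and rank \<open>k - 1\<close>
  or \<open>k\<close>. For a fixed parity of the rank, the parity of \<open>k\<close> therefore selects the sign.\<close>

text \<open>Partitions into distinct parts are represented by their sets of parts. The sum of the largest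
  part and the number of parts has the parity of the rank.\<close>

definition distinct_partitions :: "nat \<Rightarrow> bool \<Rightarrow> nat set set" where
  "distinct_partitions n q =
    {S. finite S \<and> 0 \<notin> S \<and> \<Sum>S = n \<and> (even (Max S + card S) \<longleftrightarrow> q)}"

section \<open>Franklin's two moves on sets of parts\<close>

definition top_run :: "nat set \<Rightarrow> nat" where
  "top_run S = (LEAST t. Max S - t \<notin> S)"

text \<open>With s = \<open>Min S\<close> and M = \<open>Max S\<close>, the part s is dropped and
  each of the s largest parts grows by one. If these form a run, it shifts from M + 1 - s, ..., M to
  M + 2 - s, ..., M + 1, so as a set only its two ends change.\<close>

definition top_up :: "nat set \<Rightarrow> nat set" where
  "top_up S = insert (Suc (Max S)) (S - {Min S, Suc (Max S) - Min S})"

text \<open>The reverse shift: each part of the top run, of length t, loses one, so M leaves and M -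
  t enters; the t removed units become a new part.\<close>

definition top_down :: "nat set \<Rightarrow> nat set" where
  "top_down S = insert (top_run S) (insert (Max S - top_run S) (S - {Max S}))"

text \<open>The inequation rules out that the smallest part s is itself the bottom M + 1 - s of the
  run to be shifted.\<close>

definition movable_up :: "nat set \<Rightarrow> bool" where
  "movable_up S \<longleftrightarrow> Min S \<le> top_run S \<and> Suc (Max S) \<noteq> 2 * Min S"

text \<open>Here the inequation keeps the two new parts t and M - t distinct. Under
  \<open>top_up\<close>, M + 1 and s become the new maximum and run length, so it is the image of
  the inequation in \<open>movable_up\<close>.\<close>

definition movable_down :: "nat set \<Rightarrow> bool" where
  "movable_down S \<longleftrightarrow> top_run S < Min S \<and> Max S \<noteq> 2 * top_run S"

lemma top_run_eqI:
  assumes "\<And>j. j < t \<Longrightarrow> Max S - j \<in> S" "Max S - t \<notin> S"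
  shows "top_run S = t"
  unfolding top_run_def using assms by (intro Least_equality) (auto simp: not_less[symmetric])

lemma top_run_notin: "0 \<notin> S \<Longrightarrow> Max S - top_run S \<notin> S"
  \<comment> \<open>At \<open>Max S\<close> the difference is 0, which is not in \<open>S\<close>,
    so the least number exists.\<close>
  unfolding top_run_def by (rule LeastI[of _ "Max S"]) simp

lemma top_run_in: "j < top_run S \<Longrightarrow> Max S - j \<in> S"
  unfolding top_run_def using not_less_Least by blast

lemma top_run_pos:
  assumes "finite S" "S \<noteq> {}" "0 \<notin> S"
  shows "0 < top_run S"
  using top_run_notin[of S] assms Max_in[of S] by (cases "top_run S = 0") auto

lemma finite_distinct_partitions: "finite (distinct_partitions n q)"
proof (rule finite_subset)
  show "distinct_partitions n q \<subseteq> Pow {..n}"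
  proof
    fix S assume S: "S \<in> distinct_partitions n q"
    then have "x \<le> n" if "x \<in> S" for x
      using member_le_sum[of x S "\<lambda>x. x"] that by (auto simp: distinct_partitions_def)
    then show "S \<in> Pow {..n}" by auto
  qed
qed simp

section \<open>The moves preserve the sum and undo each other\<close>

lemma top_up_properties:
  assumes fin: "finite S" and ne: "S \<noteq> {}" and pos: "0 \<notin> S" and up: "movable_up S"
  shows "finite (top_up S)" "0 \<notin> top_up S" "\<Sum>(top_up S) = \<Sum>S"
    "Max (top_up S) = Suc (Max S)" "Suc (card (top_up S)) = card S"
    "movable_down (top_up S)" "top_down (top_up S) = S"
proof -
  define s M where "s = Min S" and "M = Max S"
  have s: "s \<in> S" "\<And>x. x \<in> S \<Longrightarrow> s \<le> x" using fin ne by (auto simp: s_def)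
  have M: "M \<in> S" "\<And>x. x \<in> S \<Longrightarrow> x \<le> M" using fin ne by (auto simp: M_def)
  have "s > 0" using s pos by (cases s) auto
  have run: "M - j \<in> S" if "j < s" for j
    using top_run_in[of j S] up that by (simp add: movable_up_def s_def M_def)
  \<comment> \<open>The smallest of the s largest parts. Since s + c = M + 1, exchanging s and c for
    M + 1 preserves the sum.\<close>
  define c where "c = Suc M - s"
  have "s \<le> M" using s M by blast
  have c_eq: "c = M - (s - 1)" and sc: "c + s = Suc M" using \<open>s > 0\<close> \<open>s \<le> M\<close> by (auto simp: c_def)
  have cS: "c \<in> S" using run[of "s - 1"] \<open>s > 0\<close> c_eq by simp
  have "c \<noteq> s" using up sc by (auto simp: movable_up_def s_def M_def)
  then have "s < c" using s(2)[OF cS] by simp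
  let ?T = "top_up S"
  have T: "?T = insert (Suc M) (S - {s, c})" by (simp add: top_up_def s_def M_def c_def)
  have Suc_notin: "Suc M \<notin> S" using M(2) by force
  show finT: "finite ?T" using fin by (simp add: T)
  show "0 \<notin> ?T" using pos by (simp add: T)
  have S_eq: "S = insert s (insert c (S - {s, c}))" using s cS by blast
  have "\<Sum>S = s + c + \<Sum>(S - {s, c})"
    by (subst S_eq) (use fin \<open>s < c\<close> in simp)
  moreover have "\<Sum>?T = Suc M + \<Sum>(S - {s, c})" using fin Suc_notin by (simp add: T)
  ultimately show "\<Sum>?T = \<Sum>S" using sc by simp
  show MT: "Max ?T = Suc (Max S)"
    by (rule Max_eqI) (use finT M in \<open>auto simp: T M_def[symmetric] le_Suc_eq\<close>)
  have "card S = Suc (Suc (card (S - {s, c})))"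
    by (subst S_eq) (use fin \<open>s < c\<close> in simp)
  then show "Suc (card ?T) = card S" using fin Suc_notin by (simp add: T)
  \<comment> \<open>The run of \<open>?T\<close> consists of the s numbers c + 1, ..., M + 1 and
    stops at c, which was removed.\<close>
  have tr: "top_run ?T = s"
  proof (rule top_run_eqI)
    fix j assume "j < s"
    show "Max ?T - j \<in> ?T"
    proof (cases j)
      case 0
      then show ?thesis unfolding MT M_def[symmetric] by (simp add: T)
    next
      case (Suc i)
      then have "M - i \<in> S" "M - i > c" using run[of i] \<open>j < s\<close> \<open>s \<le> M\<close> c_eq by auto
      then show ?thesis using Suc \<open>s < c\<close> unfolding MT M_def[symmetric] by (auto simp: T)
    qed
  next
    show "Max ?T - s \<notin> ?T" using \<open>s > 0\<close> \<open>s \<le> M\<close>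
      unfolding MT M_def[symmetric] by (auto simp: T c_def)
  qed
  have "s < x" if "x \<in> ?T" for x
    using that s(2)[of x] \<open>s \<le> M\<close> by (auto simp: T order_less_le)
  then have "s < Min ?T" using finT by (subst Min_gr_iff) (auto simp: T)
  then show "movable_down ?T"
    using up tr MT by (auto simp: movable_down_def movable_up_def s_def)
  have "top_down ?T = insert s (insert c (?T - {Suc M}))"
    by (simp add: top_down_def tr MT M_def c_def)
  then show "top_down ?T = S" using Suc_notin s cS by (auto simp: T)
qed

lemma top_down_properties:
  assumes fin: "finite S" and ne: "S \<noteq> {}" and pos: "0 \<notin> S" and down: "movable_down S"
  shows "finite (top_down S)" "0 \<notin> top_down S" "\<Sum>(top_down S) = \<Sum>S"
    "Suc (Max (top_down S)) = Max S" "card (top_down S) = Suc (card S)"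
    "movable_up (top_down S)" "top_up (top_down S) = S"
proof -
  define t M where "t = top_run S" and "M = Max S"
  have M: "M \<in> S" "\<And>x. x \<in> S \<Longrightarrow> x \<le> M" using fin ne by (auto simp: M_def)
  have t: "t > 0" using top_run_pos fin ne pos by (simp add: t_def)
  have less: "t < x" if "x \<in> S" for x
  proof -
    have "Min S \<le> x" using fin that by simp
    then show ?thesis using down by (simp add: movable_down_def t_def)
  qed
  have run: "M - j \<in> S" if "j < t" for j
    using top_run_in[of j S] that by (simp add: t_def M_def)
  define c where "c = M - t"
  have "t < M" using less M by blast
  have cS: "c \<notin> S" using top_run_notin[OF pos] by (simp add: c_def M_def t_def)
  \<comment> \<open>The bottom of the run exceeds t like every part, so c is at least t; equality
    would mean M = 2t.\<close>
  have "t < M - (t - 1)" using less run[of "t - 1"] t by simp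
  moreover have "M \<noteq> 2 * t" using down by (simp add: movable_down_def t_def M_def)
  ultimately have "t < c" using t by (simp add: c_def)
  have "c < M" and tc: "t + c = M" using t \<open>t < M\<close> by (auto simp: c_def)
  have tS: "t \<notin> S" using less by blast
  let ?T = "top_down S"
  have T: "?T = insert t (insert c (S - {M}))" by (simp add: top_down_def t_def M_def c_def)
  show finT: "finite ?T" using fin by (simp add: T)
  show zT: "0 \<notin> ?T" using pos t \<open>t < c\<close> by (simp add: T)
  have "\<Sum>S = M + \<Sum>(S - {M})" using fin M by (simp add: sum.remove)
  moreover have "\<Sum>?T = t + (c + \<Sum>(S - {M}))" using fin tS cS \<open>t < c\<close> by (simp add: T)
  ultimately show "\<Sum>?T = \<Sum>S" using tc by simp
  \<comment> \<open>The last of these t numbers is the new part c; the others come from the old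
    run.\<close>
  have runT: "M - 1 - j \<in> ?T" if "j < t" for j
  proof (cases "Suc j = t")
    case True
    then show ?thesis by (auto simp: T c_def)
  next
    case False
    then have "M - Suc j \<in> S" using run that by simp
    then show ?thesis using \<open>t < M\<close> by (auto simp: T)
  qed
  have MT': "Max ?T = M - 1"
  proof (rule Max_eqI)
    show "M - 1 \<in> ?T" using runT[of 0] t by simp
    fix y assume "y \<in> ?T"
    then have "y < M" using M(2) \<open>t < M\<close> \<open>c < M\<close> by (auto simp: T order_less_le)
    then show "y \<le> M - 1" by simp
  qed (rule finT)
  then show "Suc (Max ?T) = Max S" using \<open>t < M\<close> by (simp add: M_def)
  have "card S > 0" using fin ne by (simp add: card_gt_0_iff)
  then show "card ?T = Suc (card S)" using fin M tS cS \<open>t < c\<close> by (simp add: T)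
  have mT: "Min ?T = t"
    by (rule Min_eqI) (use finT less \<open>t < c\<close> in \<open>auto simp: T intro: less_imp_le\<close>)
  \<comment> \<open>Equality can fail: the shifted run may join parts of \<open>S\<close> just below
    c. The bound suffices for \<open>movable_up\<close>.\<close>
  have "t \<le> top_run ?T"
  proof (rule ccontr)
    assume "\<not> t \<le> top_run ?T"
    then show False using runT[of "top_run ?T"] top_run_notin[OF zT] MT' by simp
  qed
  then show "movable_up ?T"
    using mT MT' \<open>M \<noteq> 2 * t\<close> \<open>t < M\<close> by (simp add: movable_up_def)
  have "top_up ?T = insert M (?T - {t, c})"
    using \<open>t < M\<close> by (simp add: top_up_def mT MT' c_def)
  then show "top_up ?T = S" using tS cS M by (auto simp: T)
qed

lemma distinct_partitions_nonempty: "S \<in> distinct_partitions n q \<Longrightarrow> n > 0 \<Longrightarrow> S \<noteq> {}"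
  by (auto simp: distinct_partitions_def)

lemma bij_betw_top_up:
  assumes "n > 0"
  shows "bij_betw top_up {S \<in> distinct_partitions n q. movable_up S}
    {S \<in> distinct_partitions n q. movable_down S}"
proof (rule bij_betw_byWitness[where f' = top_down])
  have up: "top_down (top_up S) = S \<and> top_up S \<in> distinct_partitions n q \<and> movable_down (top_up S)"
    if "S \<in> distinct_partitions n q" "movable_up S" for S
  proof -
    have S: "finite S" "S \<noteq> {}" "0 \<notin> S"
      using that distinct_partitions_nonempty[OF that(1) assms] by (auto simp: distinct_partitions_def)
    note up = top_up_properties[OF S that(2)]
    have "Max (top_up S) + card (top_up S) = Max S + card S" using up(4,5) by simp
    then show ?thesis using up that(1) by (simp only: distinct_partitions_def mem_Collect_eq simp_thms)
  qed
  have down: "top_up (top_down S) = S \<and> top_down S \<in> distinct_partitions n q \<and> movable_up (top_down S)"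
    if "S \<in> distinct_partitions n q" "movable_down S" for S
  proof -
    have S: "finite S" "S \<noteq> {}" "0 \<notin> S"
      using that distinct_partitions_nonempty[OF that(1) assms] by (auto simp: distinct_partitions_def)
    note down = top_down_properties[OF S that(2)]
    have "Max (top_down S) + card (top_down S) = Max S + card S" using down(4,5) by simp
    then show ?thesis using down that(1) by (simp only: distinct_partitions_def mem_Collect_eq simp_thms)
  qed
  show "\<forall>S\<in>{S \<in> distinct_partitions n q. movable_up S}. top_down (top_up S) = S"
    "top_up ` {S \<in> distinct_partitions n q. movable_up S} \<subseteq> {S \<in> distinct_partitions n q. movable_down S}"
    using up by auto
  show "\<forall>S\<in>{S \<in> distinct_partitions n q. movable_down S}. top_up (top_down S) = S"
    "top_down ` {S \<in> distinct_partitions n q. movable_down S} \<subseteq> {S \<in> distinct_partitions n q. movable_up S}"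
    using down by auto
qed

section \<open>The fixed points and the pentagonal numbers\<close>

definition immovable :: "nat \<Rightarrow> bool \<Rightarrow> nat set" where
  "immovable k q = (if even k = q then {Suc k..2 * k} else {k..<2 * k})"

lemma double_sum_immovable:
  "2 * \<Sum>(immovable k q) = (if even k = q then k * (3 * k + 1) else k * (3 * k - 1))"
proof -
  have low: "2 * \<Sum>{k..<2 * k} = k * (3 * k - 1)"
  proof (induction k)
    case (Suc k)
    have "{k..<2 * k + 2} = insert k {Suc k..<2 * Suc k}" by auto
    then have "\<Sum>{Suc k..<2 * Suc k} + k = \<Sum>{k..<2 * k + 2}" by simp
    also have "\<dots> = \<Sum>{k..<2 * k} + 2 * k + Suc (2 * k)" by simp
    finally show ?case using Suc by (cases k) (simp_all add: algebra_simps)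
  qed simp
  \<comment> \<open>The two intervals differ only in k being replaced by 2k.\<close>
  have high: "\<Sum>{Suc k..2 * k} = \<Sum>{k..<2 * k} + k"
  proof (cases "k = 0")
    case False
    then have "{Suc k..2 * k} = insert (2 * k) {Suc k..<2 * k}"
      and "{k..<2 * k} = insert k {Suc k..<2 * k}" by auto
    then show ?thesis by simp
  qed simp
  then show ?thesis using low by (cases k) (auto simp: immovable_def algebra_simps)
qed

text \<open>The sign may vary with k, but both pentagonal numbers of index k lie below both of index
  k + 1, as k(3k + 1) < (k + 1)(3k + 2).\<close>

lemma sum_immovable_inject:
  assumes "0 < k" "0 < j" "\<Sum>(immovable k q) = \<Sum>(immovable j q)"
  shows "k = j"
proof -
  have "\<Sum>(immovable k q) < \<Sum>(immovable j q)" if "k < j" for k j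
  proof -
    have "2 * \<Sum>(immovable k q) \<le> k * (3 * k + 1)"
      using mult_le_mono2[of "3 * k - 1" "3 * k + 1" k] by (simp add: double_sum_immovable)
    also have "\<dots> < Suc k * (3 * Suc k - 1)" by simp
    also have "\<dots> \<le> j * (3 * j - 1)" using that by (intro mult_le_mono) auto
    also have "\<dots> \<le> 2 * \<Sum>(immovable j q)"
      using mult_le_mono2[of "3 * j - 1" "3 * j + 1" j] by (simp add: double_sum_immovable)
    finally show ?thesis by simp
  qed
  then show ?thesis using assms by (metis less_irrefl nat_neq_iff)
qed

lemma Max_Min_top_run_immovable:
  assumes "k > 0"
  shows "Max {k..<2 * k} = 2 * k - 1" "Min {k..<2 * k} = k" "top_run {k..<2 * k} = k"
    "Max {Suc k..2 * k} = 2 * k" "Min {Suc k..2 * k} = Suc k" "top_run {Suc k..2 * k} = k"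
proof -
  show low: "Max {k..<2 * k} = 2 * k - 1" by (rule Max_eqI) (use assms in auto)
  show "Min {k..<2 * k} = k" by (rule Min_eqI) (use assms in auto)
  show "top_run {k..<2 * k} = k" by (rule top_run_eqI) (use assms in \<open>auto simp: low\<close>)
  show high: "Max {Suc k..2 * k} = 2 * k" by (rule Max_eqI) (use assms in auto)
  show "Min {Suc k..2 * k} = Suc k" by (rule Min_eqI) (use assms in auto)
  show "top_run {Suc k..2 * k} = k" by (rule top_run_eqI) (use assms in \<open>auto simp: high\<close>)
qed

text \<open>Largest part plus number of parts is 3k - 1 for the lower interval and 3k for the upper
  one. For each positive k exactly one of them has the parity prescribed by \<open>q\<close>, and
  \<open>immovable\<close> selects it.\<close>

lemma immovable_in_distinct_partitions:
  assumes "k > 0"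
  shows "immovable k q \<in> distinct_partitions (\<Sum>(immovable k q)) q"
    "\<not> movable_up (immovable k q)" "\<not> movable_down (immovable k q)"
  using assms
  by (auto simp: immovable_def distinct_partitions_def movable_up_def movable_down_def
      Max_Min_top_run_immovable)

text \<open>Each failing inequation fixes M in terms of s or t. This confines \<open>S\<close> to an
  interval that the top run already fills.\<close>

lemma not_movable_imp_immovable:
  assumes S: "S \<in> distinct_partitions n q" and "n > 0" "\<not> movable_up S" "\<not> movable_down S"
  shows "\<exists>k>0. S = immovable k q"
proof -
  have fin: "finite S" "S \<noteq> {}" "0 \<notin> S"
    using S distinct_partitions_nonempty[OF S \<open>n > 0\<close>] by (auto simp: distinct_partitions_def)
  define s t M where "s = Min S" and "t = top_run S" and "M = Max S"
  have s: "s \<in> S" "\<And>x. x \<in> S \<Longrightarrow> s \<le> x" using fin by (auto simp: s_def)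
  have M: "M \<in> S" "\<And>x. x \<in> S \<Longrightarrow> x \<le> M" using fin by (auto simp: M_def)
  have "s > 0" using s fin by (cases s) auto
  have "t > 0" using top_run_pos fin by (simp add: t_def)
  have run: "x \<in> S" if "M < x + t" "x \<le> M" for x
    using top_run_in[of "M - x" S] that by (simp add: t_def M_def less_diff_conv2)
  have par: "even (M + card S) = q" using S by (simp add: distinct_partitions_def M_def)
  show ?thesis
  proof (cases "s \<le> t")
    case True
    then have M_eq: "Suc M = 2 * s" using assms(3) by (simp add: movable_up_def s_def t_def M_def)
    have "S = {s..<2 * s}"
    proof
      show "S \<subseteq> {s..<2 * s}" using s(2) M(2) M_eq by fastforce
      show "{s..<2 * s} \<subseteq> S" using run True M_eq by auto
    qed
    \<comment> \<open>Here \<open>M + card S\<close> is 3s - 1, whose parity is opposite to that of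
      s.\<close>
    moreover from this have "even s \<noteq> q" using par M_eq
      by (metis card_atLeastLessThan add_diff_cancel_left' mult_2 dvd_triv_left even_Suc even_add)
    ultimately show ?thesis using \<open>s > 0\<close> by (auto simp: immovable_def)
  next
    case False
    then have M_eq: "M = 2 * t" using assms(4) by (simp add: movable_down_def s_def t_def M_def)
    have "S = {Suc t..2 * t}"
    proof
      show "S \<subseteq> {Suc t..2 * t}" using s(2) M(2) M_eq False by fastforce
      show "{Suc t..2 * t} \<subseteq> S" using run M_eq by auto
    qed
    moreover from this have "even t = q" using par M_eq by auto
    ultimately show ?thesis using \<open>t > 0\<close> by (auto simp: immovable_def)
  qed
qed

section \<open>Counting modulo 2\<close>

lemma odd_card_distinct_partitions:
  assumes "n > 0"
  shows "odd (card (distinct_partitions n q)) \<longleftrightarrow> (\<exists>k>0. n = \<Sum>(immovable k q))"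
proof -
  let ?D = "distinct_partitions n q"
  let ?U = "{S \<in> ?D. movable_up S}" and ?L = "{S \<in> ?D. movable_down S}"
  let ?F = "{S \<in> ?D. \<not> movable_up S \<and> \<not> movable_down S}"
  have fin: "finite ?U" "finite ?L" "finite ?F" using finite_distinct_partitions by auto
  have "?D = ?U \<union> ?L \<union> ?F" by blast
  moreover have "card (?U \<union> ?L \<union> ?F) = card ?U + card ?L + card ?F"
    \<comment> \<open>No set is movable both ways, since \<open>Min S\<close> is compared with
      \<open>top_run S\<close> in opposite senses.\<close>
    using fin by (subst card_Un_disjoint; auto simp: movable_up_def movable_down_def)+
  moreover have "card ?U = card ?L" using bij_betw_top_up[OF assms] by (rule bij_betw_same_card)
  ultimately have "odd (card ?D) \<longleftrightarrow> odd (card ?F)" by simp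
  also have "?F = {immovable k q |k. k > 0 \<and> n = \<Sum>(immovable k q)}" (is "_ = ?G")
  proof (intro subset_antisym subsetI)
    fix S assume S: "S \<in> ?F"
    then obtain k where k: "k > 0" "S = immovable k q"
      using not_movable_imp_immovable assms by blast
    moreover have "\<Sum>S = n" using S by (simp add: distinct_partitions_def)
    ultimately show "S \<in> ?G" by blast
  qed (use immovable_in_distinct_partitions in auto)
  also have "odd (card ?G) \<longleftrightarrow> (\<exists>k>0. n = \<Sum>(immovable k q))"
  proof (cases "\<exists>k>0. n = \<Sum>(immovable k q)")
    case True
    then obtain k where "k > 0" "n = \<Sum>(immovable k q)" by blast
    \<comment> \<open>Distinct positive indices give distinct sums, so there is at most one fixed
      point for given n and \<open>q\<close>.\<close>
    then have "?G = {immovable k q}" using sum_immovable_inject by blast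
    then show ?thesis using True by simp
  next
    case False
    then have "?G = {}" by blast
    then show ?thesis using False by (simp only: card.empty) simp
  qed
  finally show ?thesis .
qed

section \<open>Back to multisets and to the closed formulas\<close>

lemma mset_set_set_mset_distinct: "distinct_parts p \<Longrightarrow> mset_set (set_mset p) = p"
  by (intro multiset_eqI)
    (metis One_nat_def count_eq_zero_iff count_mset_set(1,3) distinct_parts_def finite_set_mset
      le_antisym less_one not_less)

text \<open>The rank is a difference and \<open>distinct_partitions\<close> uses the sum of the same
  two numbers, which has the same parity. For n = 0 the term \<open>Max {}\<close> occurs on both
  sides, so its value is irrelevant.\<close>

lemma card_partitions_eq_card_distinct_partitions:
  "card {p \<in> partitions n. distinct_parts p \<and> (even (partition_rank p) \<longleftrightarrow> q)} =
    card (distinct_partitions n q)"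
proof (rule bij_betw_same_card)
  have sum_set: "\<Sum>(set_mset p) = sum_mset p" and card_set: "card (set_mset p) = size p"
    if "distinct_parts p" for p
  proof -
    have p: "mset_set (set_mset p) = p" by (rule mset_set_set_mset_distinct[OF that])
    have "\<Sum>(set_mset p) = sum_mset (mset_set (set_mset p))"
      by (simp add: sum_unfold_sum_mset)
    with p show "\<Sum>(set_mset p) = sum_mset p" by simp
    have "card (set_mset p) = size (mset_set (set_mset p))" by simp
    with p show "card (set_mset p) = size p" by simp
  qed
  have dist: "distinct_parts (mset_set S)" if "finite S" for S
    using that by (auto simp: distinct_parts_def count_mset_set')
  show "bij_betw set_mset {p \<in> partitions n. distinct_parts p \<and> (even (partition_rank p) \<longleftrightarrow> q)}
    (distinct_partitions n q)"
    by (rule bij_betw_byWitness[where f' = mset_set])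
      (auto simp: partitions_def distinct_partitions_def partition_rank_def sum_set card_set dist
        mset_set_set_mset_distinct sum_unfold_sum_mset)
qed

text \<open>The sign in the formula is +1 exactly when \<open>even k = q\<close>, the case
  distinction of \<open>immovable\<close>. Positivity of k makes 3k - 1 an honest difference in the
  passage to the reals.\<close>

lemma sum_immovable_eq_iff:
  assumes "k > 0"
  shows "n = \<Sum>(immovable k q) \<longleftrightarrow>
    real n = real k * (3 * real k + (if q then (-1) ^ k else - ((-1) ^ k))) / 2"
proof -
  have "n = \<Sum>(immovable k q) \<longleftrightarrow> real (2 * n) = real (2 * \<Sum>(immovable k q))" by linarith
  also have "real (2 * \<Sum>(immovable k q)) =
      real k * (3 * real k + (if q then (-1) ^ k else - ((-1) ^ k)))"
    unfolding double_sum_immovable using assms by (cases "even k") (auto simp: of_nat_diff algebra_simps)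
  finally show ?thesis by auto
qed

theorem theorem4p2:
  fixes n :: nat
  assumes "n > 0"
  shows "(odd (card {p \<in> partitions n. distinct_parts p \<and> odd (partition_rank p)}) \<longleftrightarrow>
           (\<exists>k::nat. k > 0 \<and> real n = real k * (3 * real k - (-1) ^ k) / 2)) \<and>
         (odd (card {p \<in> partitions n. distinct_parts p \<and> even (partition_rank p)}) \<longleftrightarrow>
           (\<exists>k::nat. k > 0 \<and> real n = real k * (3 * real k + (-1) ^ k) / 2))"
proof -
  have "odd (card {p \<in> partitions n. distinct_parts p \<and> (even (partition_rank p) \<longleftrightarrow> q)}) \<longleftrightarrow>
      (\<exists>k>0. real n = real k * (3 * real k + (if q then (-1) ^ k else - ((-1) ^ k))) / 2)" for q
    unfolding card_partitions_eq_card_distinct_partitions odd_card_distinct_partitions[OF assms]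
    using sum_immovable_eq_iff by blast
  from this[of False] this[of True] show ?thesis by simp
qed

end
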